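(* Let $\mathrm{K}_V^{\mathbf t}$ be a complete $\mathbf t$-spread $d$-partite hypergraph. Then the set $\mathcal{G}(I(\mathrm{K}_V^{\mathbf t}))$ is sortable.
   Context: Setting. Let $n,d\ge 1$ be integers, $[n]=\{1,\dots,n\}$, and let $\mathbf t=(t_1,\dots,t_{d-1})$ be a vector of integers with $t_i\ge 1$ for all $i$. Let $V=\{V_1,\dots,V_d\}$ be a family of nonempty, pairwise disjoint subsets of $[n]$ such that $p<q$ whenever $p\in V_i$, $q\in V_j$ and $i<j$. A $\mathbf t$-spread edge is a set $\{k_1,\dots,k_d\}$ with $k_j\in V_j$ for $j=1,\dots,d$ and $k_j-k_{j-1}\ge t_{j-1}$ for $j=2,\dots,d$. The complete $\mathbf t$-spread $d$-partite hypergraph $\mathrm{K}_V^{\mathbf t}$ is the hypergraph with vertex set $V(\mathrm{K}_V^{\mathbf t})=V_1\cup\dots\cup V_d$ whose edges are all the $\mathbf t$-spread edges. Standing assumption: $\mathrm{K}_V^{\mathbf t}$ has no isolated vertices, i.e. every vertex belongs to at least one edge. Let $\mathbb{K}$ be a field and $S=\mathbb{K}[x_1,\dots,x_n]$. The edge ideal $I(\mathrm{K}_V^{\mathbf t})\subset S$ is the ideal generated by the monomials $x_{k_1}\cdots x_{k_d}$, where $\{k_1,\dots,k_d\}$ runs over the edges of $\mathrm{K}_V^{\mathbf t}$. $\mathcal{G}(I)$ denotes the minimal set of monomial generators of a monomial ideal $I$. For monomials $u,v$ of degree $d$ in $S$, write $uv=x_{i_1}x_{i_2}\cdots x_{i_{2d}}$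 with $i_1\le i_2\le\dots\le i_{2d}$ and set $\mathrm{sort}(u,v)=(u',v')$ with $u'=x_{i_1}x_{i_3}\cdots x_{i_{2d-1}}$ and $v'=x_{i_2}x_{i_4}\cdots x_{i_{2d}}$. A set $A$ of monomials of degree $d$ is sortable if $\mathrm{sort}(A\times A)\subseteq A\times A$. *)

theory Defs
  imports
    "HOL-Library.Multiset"
    "HOL-Library.Disjoint_Sets"
    "HOL-Library.Poly_Mapping"
    "HOL-Algebra.Ideal"
begin

text \<open>
  A monomial is the multiset of the indices of its variables, with multiplicity: \<open>x\<^sub>1\<^sup>2x\<^sub>3\<close> is
  \<open>{#1, 1, 3#}\<close>. Then the degree is \<^const>\<open>size\<close>, the product of monomials is the sum of multisets,
  and finitely supported functions from monomials to coefficients, with the convolution product of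
  \<^theory>\<open>HOL-Library.Poly_Mapping\<close>, are the polynomials in the variables \<open>x\<^sub>0, x\<^sub>1, x\<^sub>2, \<dots>\<close>.
\<close>

type_synonym monomial = "nat multiset"

type_synonym 'k mpoly = "monomial \<Rightarrow>\<^sub>0 'k"

definition mono_poly :: "monomial \<Rightarrow> 'k::comm_ring_1 mpoly"
  where "mono_poly m = Poly_Mapping.single m 1"

definition var :: "nat \<Rightarrow> 'k::comm_ring_1 mpoly"
  where "var i = mono_poly {#i#}"

definition monomials :: "nat \<Rightarrow> monomial set"
  where "monomials n = {m. set_mset m \<subseteq> {1..n}}"

text \<open>The ring \<open>S = K[x\<^sub>1, \<dots>, x\<^sub>n]\<close>.\<close>

definition poly_ring :: "nat \<Rightarrow> 'k::comm_ring_1 mpoly ring"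
  where "poly_ring n =
    \<lparr>carrier = {p. Poly_Mapping.keys p \<subseteq> monomials n},
     monoid.mult = (*), one = 1, zero = 0, add = (+)\<rparr>"

lemma cring_poly_ring: "cring (poly_ring n :: 'k::comm_ring_1 mpoly ring)"
proof (intro cringI abelian_groupI comm_monoidI; unfold poly_ring_def monoid.simps ring.simps
    partial_object.simps mem_Collect_eq)
  fix p q :: "'k mpoly"
  assume pq: "Poly_Mapping.keys p \<subseteq> monomials n" "Poly_Mapping.keys q \<subseteq> monomials n"
  show "Poly_Mapping.keys (p + q) \<subseteq> monomials n"
    using pq Poly_Mapping.keys_add[of p q] by blast
  show "Poly_Mapping.keys (p * q) \<subseteq> monomials n"
    using pq keys_mult[of p q] by (fastforce simp: monomials_def)
  show "\<exists>y\<in>{p. Poly_Mapping.keys p \<subseteq> monomials n}. y + p = 0"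
    using pq by (intro bexI[of _ "- p"]) auto
qed (auto simp: algebra_simps monomials_def)

text \<open>
  \<open>\<G>(I)\<close>: the set of monomials of \<open>S\<close> that generates the monomial ideal \<open>I\<close> and is minimal with
  respect to inclusion among such sets. Every monomial ideal has exactly one such set; the value is
  unspecified if \<open>I\<close> is not a monomial ideal.
\<close>

definition is_min_mono_gens :: "nat \<Rightarrow> 'k::comm_ring_1 mpoly set \<Rightarrow> monomial set \<Rightarrow> bool"
  where "is_min_mono_gens n I A \<longleftrightarrow>
    A \<subseteq> monomials n \<and>
    Idl\<^bsub>poly_ring n\<^esub> (mono_poly ` A) = I \<and>
    (\<forall>B. B \<subset> A \<longrightarrow> Idl\<^bsub>poly_ring n\<^esub> (mono_poly ` B) \<noteq> I)"

definition min_mono_gens :: "nat \<Rightarrow> 'k::comm_ring_1 mpoly set \<Rightarrow> monomial set"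
  where "min_mono_gens n I = (THE A. is_min_mono_gens n I A)"

text \<open>
  Lists are indexed from 0, so the factors \<open>x\<^bsub>i\<^sub>1\<^esub>, x\<^bsub>i\<^sub>3\<^esub>, \<dots>\<close> are those in even positions.
\<close>

definition sort_pair :: "monomial \<times> monomial \<Rightarrow> monomial \<times> monomial"
  where "sort_pair = (\<lambda>(u, v).
    let is = sorted_list_of_multiset (u + v)
    in (mset (nths is {i. even i}), mset (nths is {i. odd i})))"

definition sortable :: "nat \<Rightarrow> monomial set \<Rightarrow> bool"
  where "sortable d A \<longleftrightarrow> (\<forall>u\<in>A. size u = d) \<and> sort_pair ` (A \<times> A) \<subseteq> A \<times> A"

text \<open>
  The hypergraph \<open>K\<^sub>V\<^sup>t\<close>, with \<open>V\<close> used at the indices \<open>1, \<dots>, d\<close> and \<open>t\<close> at \<open>1, \<dots>, d - 1\<close> only.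
\<close>

definition spread_vertices :: "nat \<Rightarrow> (nat \<Rightarrow> nat set) \<Rightarrow> nat set"
  where "spread_vertices d V = (\<Union>j\<in>{1..d}. V j)"

definition spread_edges :: "nat \<Rightarrow> (nat \<Rightarrow> int) \<Rightarrow> (nat \<Rightarrow> nat set) \<Rightarrow> nat set set"
  where "spread_edges d t V =
    {k ` {1..d} | k. (\<forall>j\<in>{1..d}. k j \<in> V j) \<and>
                     (\<forall>j\<in>{2..d}. int (k j) - int (k (j - 1)) \<ge> t (j - 1))}"

definition edge_ideal :: "nat \<Rightarrow> nat set set \<Rightarrow> 'k::comm_ring_1 mpoly set"
  where "edge_ideal n E = Idl\<^bsub>poly_ring n\<^esub> ((\<lambda>e. \<Prod>i\<in>e. var i) ` E)"

end

theory Submission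
  imports Defs
begin

text \<open>
  All edges have exactly \<open>d\<close> vertices, so no generator \<open>x\<^bsub>k\<^sub>1\<^esub> \<cdots> x\<^bsub>k\<^sub>d\<^esub>\<close> properly divides another one. A
  monomial that lies in an ideal generated by monomials is divisible by one of them; hence an
  antichain of monomials is the unique minimal monomial generating set of its ideal
  (\<open>min_mono_gens_antichain\<close>), and \<open>\<G>(I)\<close> consists precisely of the edge monomials.

  Now take two edges \<open>k\<^sub>1 < \<dots> < k\<^sub>d\<close> and \<open>l\<^sub>1 < \<dots> < l\<^sub>d\<close> with \<open>k\<^sub>j, l\<^sub>j \<in> V\<^sub>j\<close>. Since every element of
  \<open>V\<^sub>j\<close> lies below every element of \<open>V\<^sub>j\<^sub>+\<^sub>1\<close>, the sorted list of all \<open>2d\<close> indices is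
  \<open>min k\<^sub>1 l\<^sub>1, max k\<^sub>1 l\<^sub>1, min k\<^sub>2 l\<^sub>2, max k\<^sub>2 l\<^sub>2, \<dots>\<close>. So sorting replaces the two sequences by their
  pointwise minimum and pointwise maximum (\<open>sort_pair_min_max\<close>). Both remain in \<open>V\<^sub>1 \<times> \<cdots> \<times> V\<^sub>d\<close>, and
  both inherit the lower bounds on consecutive differences: if, for instance, \<open>min k\<^sub>j l\<^sub>j = k\<^sub>j\<close>, then
  \<open>min k\<^sub>j l\<^sub>j - min k\<^sub>j\<^sub>-\<^sub>1 l\<^sub>j\<^sub>-\<^sub>1 \<ge> k\<^sub>j - k\<^sub>j\<^sub>-\<^sub>1\<close>.
\<close>

lemma prod_var_eq_mono_poly: "(\<Prod>i\<in>e. var i) = (mono_poly (mset_set e) :: 'k::comm_ring_1 mpoly)"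
  by (induction e rule: infinite_finite_induct)
    (simp_all add: var_def mono_poly_def mult_single)

lemma mono_poly_in_poly_ring: "m \<in> monomials n \<Longrightarrow> mono_poly m \<in> carrier (poly_ring n)"
  by (simp add: poly_ring_def mono_poly_def)

text \<open>
  This ideal contains the monomials of \<open>A\<close> and so bounds the ideal that they generate from above.
  Closure under multiplication holds because each monomial of \<open>q * p\<close> is a multiple of a monomial
  of \<open>p\<close>.
\<close>

lemma ideal_keys_multiples:
  "ideal {p \<in> carrier (poly_ring n). \<forall>m\<in>Poly_Mapping.keys p. \<exists>a\<in>A. a \<subseteq># m}
     (poly_ring n :: 'k::comm_ring_1 mpoly ring)"
    (is "ideal ?J ?R")
proof -
  interpret R: cring ?R by (rule cring_poly_ring)
  have mult: "q * p \<in> ?J" if p: "p \<in> ?J" and q: "q \<in> carrier ?R" for p q :: "'k mpoly"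
  proof -
    have "q * p \<in> carrier ?R"
      using R.m_closed[of q p] p q by (simp add: poly_ring_def)
    moreover have "\<exists>a\<in>A. a \<subseteq># m" if m: "m \<in> Poly_Mapping.keys (q * p)" for m
    proof -
      obtain x y where "m = x + y" "y \<in> Poly_Mapping.keys p"
        using m keys_mult[of q p] by blast
      moreover from this obtain a where "a \<in> A" "a \<subseteq># y" using p by blast
      ultimately show ?thesis
        by (metis mset_subset_eq_add_right subset_mset.order_trans)
    qed
    ultimately show ?thesis by blast
  qed
  have neg: "- p \<in> ?J" if "p \<in> ?J" for p
    using that by (simp add: poly_ring_def)
  have add: "p + q \<in> ?J" if "p \<in> ?J" "q \<in> ?J" for p q
    using that Poly_Mapping.keys_add[of p q] by (auto simp: poly_ring_def)
  show ?thesis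
  proof (rule idealI)
    show "ring ?R" by (rule R.ring_axioms)
    show "subgroup ?J (add_monoid ?R)"
    proof (rule group.subgroupI)
      show "group (add_monoid ?R)" by (rule R.a_group)
      show "?J \<noteq> {}" by (auto simp: poly_ring_def intro!: exI[of _ 0])
      show "inv\<^bsub>add_monoid ?R\<^esub> p \<in> ?J" if p: "p \<in> ?J" for p
      proof -
        have "\<ominus>\<^bsub>?R\<^esub> p = - p"
          using p neg[OF p] by (intro R.minus_equality) (auto simp: poly_ring_def)
        then show ?thesis using neg[OF p] by (simp add: a_inv_def)
      qed
      show "p \<otimes>\<^bsub>add_monoid ?R\<^esub> q \<in> ?J" if "p \<in> ?J" "q \<in> ?J" for p q
        using add[OF that] by (simp add: poly_ring_def)
    qed auto
    show "x \<otimes>\<^bsub>?R\<^esub> p \<in> ?J" if "p \<in> ?J" "x \<in> carrier ?R" for p x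
      using mult[OF that] by (simp add: poly_ring_def)
    show "p \<otimes>\<^bsub>?R\<^esub> x \<in> ?J" if "p \<in> ?J" "x \<in> carrier ?R" for p x
      using mult[OF that] by (simp add: poly_ring_def mult.commute)
  qed
qed

lemma mono_poly_in_genideal_imp_dvd:
  assumes A: "A \<subseteq> monomials n"
    and m: "(mono_poly m :: 'k::comm_ring_1 mpoly) \<in> Idl\<^bsub>poly_ring n\<^esub> (mono_poly ` A)"
  shows "\<exists>a\<in>A. a \<subseteq># m"
proof -
  let ?R = "poly_ring n :: 'k mpoly ring"
  let ?J = "{p \<in> carrier ?R. \<forall>m\<in>Poly_Mapping.keys p. \<exists>a\<in>A. a \<subseteq># m}"
  interpret R: cring ?R by (rule cring_poly_ring)
  have "mono_poly ` A \<subseteq> ?J"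
    using A mono_poly_in_poly_ring by (fastforce simp: mono_poly_def)
  then have "Idl\<^bsub>?R\<^esub> (mono_poly ` A) \<subseteq> ?J"
    by (intro R.genideal_minimal ideal_keys_multiples)
  then show ?thesis using m by (auto simp: mono_poly_def)
qed

text \<open>
  If \<open>B\<close> generates the same ideal as \<open>A\<close>, then each \<open>a \<in> A\<close> is a multiple of some \<open>b \<in> B\<close>, which in
  turn is a multiple of some \<open>a' \<in> A\<close>. The antichain condition forces \<open>a' = a\<close>, hence \<open>b = a\<close>: every
  monomial generating set contains \<open>A\<close>.
\<close>

lemma antichain_subset_mono_gens:
  assumes A: "A \<subseteq> monomials n" and B: "B \<subseteq> monomials n"
    and antichain: "\<And>a b. a \<in> A \<Longrightarrow> b \<in> A \<Longrightarrow> a \<subseteq># b \<Longrightarrow> a = b"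
    and eq: "Idl\<^bsub>poly_ring n\<^esub> (mono_poly ` B) =
      (Idl\<^bsub>poly_ring n\<^esub> (mono_poly ` A) :: 'k::comm_ring_1 mpoly set)"
  shows "A \<subseteq> B"
proof
  fix a assume a: "a \<in> A"
  interpret R: cring "poly_ring n :: 'k mpoly ring" by (rule cring_poly_ring)
  have gen: "(mono_poly m :: 'k mpoly) \<in> Idl\<^bsub>poly_ring n\<^esub> (mono_poly ` C)"
    if "m \<in> C" "C \<subseteq> monomials n" for m C
    using R.genideal_self[of "mono_poly ` C"] that mono_poly_in_poly_ring by blast
  obtain b where b: "b \<in> B" "b \<subseteq># a"
    using mono_poly_in_genideal_imp_dvd[OF B, of a] gen[OF a A] eq by auto
  obtain a' where a': "a' \<in> A" "a' \<subseteq># b"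
    using mono_poly_in_genideal_imp_dvd[OF A, of b] gen[OF b(1) B] eq by auto
  have "a' = a"
    using antichain a a' b by (meson subset_mset.order_trans)
  then show "a \<in> B"
    using a' b subset_mset.antisym by blast
qed

lemma min_mono_gens_antichain:
  assumes A: "A \<subseteq> monomials n"
    and antichain: "\<And>a b. a \<in> A \<Longrightarrow> b \<in> A \<Longrightarrow> a \<subseteq># b \<Longrightarrow> a = b"
  shows "min_mono_gens n (Idl\<^bsub>poly_ring n\<^esub> (mono_poly ` A) :: 'k::comm_ring_1 mpoly set) = A"
  unfolding min_mono_gens_def
proof (rule the_equality)
  let ?I = "Idl\<^bsub>poly_ring n\<^esub> (mono_poly ` A) :: 'k mpoly set"
  have sub: "A \<subseteq> B"
    if "B \<subseteq> monomials n" "Idl\<^bsub>poly_ring n\<^esub> (mono_poly ` B) = ?I" for B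
    using antichain_subset_mono_gens[OF A that(1) antichain that(2)] .
  show "is_min_mono_gens n ?I A"
    unfolding is_min_mono_gens_def using A sub by blast
  show "B = A" if "is_min_mono_gens n ?I B" for B
    using that sub[of B] unfolding is_min_mono_gens_def by blast
qed

lemma nths_interleaved:
  "nths (concat (map (\<lambda>j. [f j, g j]) js)) {i. even i} = map f js"
  "nths (concat (map (\<lambda>j. [f j, g j]) js)) {i. odd i} = map g js"
  by (induction js) (simp_all add: nths_Cons)

lemma sorted_interleaved:
  assumes "sorted_wrt (\<lambda>i j. g i \<le> f j) js" and "\<And>j. j \<in> set js \<Longrightarrow> f j \<le> g j"
  shows "sorted (concat (map (\<lambda>j. [f j, g j]) js))"
  using assms
proof (induction js)
  case (Cons a js)
  have "f a \<le> g a" "g a \<le> f j" "f j \<le> g j" if "j \<in> set js" for j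
    using Cons.prems that by auto
  then have "f a \<le> f j \<and> f a \<le> g j \<and> g a \<le> g j" if "j \<in> set js" for j
    using that by (meson order_trans)
  then show ?case
    using Cons by simp
qed simp

text \<open>
  The hypothesis says that the pairs \<open>{k j, l j}\<close> occupy successive ranges that meet at most in
  their endpoints. Writing each pair in increasing order therefore sorts all the
  indices, and puts the minima in the even and the maxima in the odd positions.
\<close>

lemma sort_pair_min_max:
  fixes k l :: "'a \<Rightarrow> nat"
  assumes "sorted_wrt (\<lambda>i j. max (k i) (l i) \<le> min (k j) (l j)) js"
  shows "sort_pair (mset (map k js), mset (map l js)) =
    (mset (map (\<lambda>j. min (k j) (l j)) js), mset (map (\<lambda>j. max (k j) (l j)) js))"
proof -
  let ?xs = "concat (map (\<lambda>j. [min (k j) (l j), max (k j) (l j)]) js)"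
  have "mset (map k js) + mset (map l js) = mset ?xs"
    by (induction js) (auto simp: min_def max_def)
  moreover have "sorted ?xs"
    by (rule sorted_interleaved[OF assms]) simp
  ultimately have "sorted_list_of_multiset (mset (map k js) + mset (map l js)) = ?xs"
    by (simp add: sorted_sort_id)
  then show ?thesis
    by (simp only: sort_pair_def prod.case Let_def nths_interleaved)
qed

theorem proposition3p1:
  fixes n d :: nat and t :: "nat \<Rightarrow> int" and V :: "nat \<Rightarrow> nat set"
  assumes "n \<ge> 1" and "d \<ge> 1"
    and "\<And>i. i \<in> {1..d - 1} \<Longrightarrow> t i \<ge> 1"
    and "\<And>i. i \<in> {1..d} \<Longrightarrow> V i \<noteq> {} \<and> V i \<subseteq> {1..n}"
    and "disjoint_family_on V {1..d}"
    and "\<And>i j p q. \<lbrakk>i \<in> {1..d}; j \<in> {1..d}; i < j; p \<in> V i; q \<in> V j\<rbrakk> \<Longrightarrow> p < q"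
    and no_isolated: "\<And>v. v \<in> spread_vertices d V \<Longrightarrow> \<exists>e\<in>spread_edges d t V. v \<in> e"
  shows "sortable d (min_mono_gens n (edge_ideal n (spread_edges d t V) :: 'k::field mpoly set))"
proof -
  let ?js = "[1..<Suc d]"
  define spread where "spread k \<longleftrightarrow> (\<forall>j\<in>{1..d}. k j \<in> V j) \<and>
    (\<forall>j\<in>{2..d}. int (k j) - int (k (j - 1)) \<ge> t (j - 1))" for k :: "nat \<Rightarrow> nat"
  define mon where "mon k = mset (map k ?js)" for k :: "nat \<Rightarrow> nat"
  define A where "A = mset_set ` spread_edges d t V"
  have mset_set_edge: "mset_set (k ` {1..d}) = mon k" if "spread k" for k
  proof -
    have "strict_mono_on {1..d} k"
      using that assms(6) unfolding spread_def strict_mono_on_def by blast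
    then have "mset_set (k ` {1..d}) = image_mset k (mset_set {1..d})"
      by (intro image_mset_mset_set[symmetric] strict_mono_on_imp_inj_on)
    also have "mset_set {1..d} = mset ?js"
      using mset_upt[of 1 "Suc d"] by (simp add: atLeastLessThanSuc_atLeastAtMost)
    finally show ?thesis by (simp add: mon_def)
  qed
  have A_eq: "A = {mon k | k. spread k}"
    unfolding A_def spread_edges_def spread_def[symmetric] setcompr_eq_image image_image
    using mset_set_edge by (intro image_cong) auto
  have A_monomials: "A \<subseteq> monomials n"
    using assms(4) by (fastforce simp: A_eq spread_def mon_def monomials_def)
  have size_A: "size a = d" if "a \<in> A" for a
    using that by (auto simp: A_eq mon_def)
  have "edge_ideal n (spread_edges d t V) =
      (Idl\<^bsub>poly_ring n\<^esub> (mono_poly ` A) :: 'k mpoly set)"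
    by (simp add: edge_ideal_def A_def prod_var_eq_mono_poly image_image)
  moreover have "a = b" if "a \<in> A" "b \<in> A" "a \<subseteq># b" for a b
    using that size_A by (metis mset_subset_size subset_mset.le_neq_trans less_irrefl)
  ultimately have gens: "min_mono_gens n (edge_ideal n (spread_edges d t V) :: 'k mpoly set) = A"
    using min_mono_gens_antichain[OF A_monomials] by metis
  have "sort_pair (mon k, mon l) \<in> A \<times> A" if k: "spread k" and l: "spread l" for k l
  proof -
    have "sorted_wrt (\<lambda>i j. max (k i) (l i) \<le> min (k j) (l j)) ?js"
    proof (rule sorted_wrt_mono_rel)
      show "sorted_wrt (<) ?js" by (rule sorted_wrt_upt)
    next
      fix i j assume "i \<in> set ?js" "j \<in> set ?js" "i < j"
      then have ij: "i \<in> {1..d}" "j \<in> {1..d}" "i < j" by auto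
      with k l have "k i \<in> V i" "l i \<in> V i" "k j \<in> V j" "l j \<in> V j"
        by (auto simp: spread_def)
      then have "k i < k j" "k i < l j" "l i < k j" "l i < l j"
        by (simp_all only: assms(6)[OF ij])
      then show "max (k i) (l i) \<le> min (k j) (l j)" by simp
    qed
    then have "sort_pair (mon k, mon l) =
        (mon (\<lambda>j. min (k j) (l j)), mon (\<lambda>j. max (k j) (l j)))"
      unfolding mon_def by (rule sort_pair_min_max)
    moreover have "spread (\<lambda>j. min (k j) (l j))"
      unfolding spread_def
    proof (intro conjI ballI)
      show "min (k j) (l j) \<in> V j" if "j \<in> {1..d}" for j
        using k l that by (simp add: spread_def min_def)
      show "t (j - 1) \<le> int (min (k j) (l j)) - int (min (k (j - 1)) (l (j - 1)))"
        if j: "j \<in> {2..d}" for j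
      proof -
        have "t (j - 1) \<le> int (k j) - int (k (j - 1))" "t (j - 1) \<le> int (l j) - int (l (j - 1))"
          using k l j by (auto simp: spread_def)
        then show ?thesis by linarith
      qed
    qed
    moreover have "spread (\<lambda>j. max (k j) (l j))"
      unfolding spread_def
    proof (intro conjI ballI)
      show "max (k j) (l j) \<in> V j" if "j \<in> {1..d}" for j
        using k l that by (simp add: spread_def max_def)
      show "t (j - 1) \<le> int (max (k j) (l j)) - int (max (k (j - 1)) (l (j - 1)))"
        if j: "j \<in> {2..d}" for j
      proof -
        have "t (j - 1) \<le> int (k j) - int (k (j - 1))" "t (j - 1) \<le> int (l j) - int (l (j - 1))"
          using k l j by (auto simp: spread_def)
        then show ?thesis by linarith
      qed
    qed
    ultimately show ?thesis by (auto simp: A_eq)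
  qed
  then have "sort_pair ` (A \<times> A) \<subseteq> A \<times> A"
    unfolding A_eq by blast
  with size_A show ?thesis
    unfolding gens sortable_def by blast
qed

end
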